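(* Let $\mathscr{G} = (\mathscr{V}, \mathscr{E})$ be a finite simple undirected $D$-regular graph with $N$ vertices, let $p \in (0,1)$, and let $S$ be the size of the open cluster of a uniformly random vertex in bond percolation with parameter $p$ on $\mathscr{G}$. Set $\nu = (D-1)p$ and $R = N-1$, and suppose $\nu \neq 1$ (so that the expressions below are defined). Then $$E(S) \leq 1 + Dp\left(\frac{1-\nu^R}{1-\nu}\right)$$ and $$E(S^2) \leq \left(1 + Dp\left(\frac{1-\nu^R}{1-\nu}\right)\right)^2 + \frac{Dp(1-p)}{(1-\nu)^2}\left(\frac{(1-\nu^R)(1+\nu^{R+1})}{1-\nu} - 2R\,\nu^R\right).$$
   Context: Bond percolation with parameter $p$ on a finite simple undirected graph $\mathscr{G}=(\mathscr{V},\mathscr{E})$: $(\zeta(e))_{e\in\mathscr{E}}$ are independent Bernoulli($p$) random variables; edge $e$ is open if $\zeta(e)=1$ and closed if $\zeta(e)=0$. For a vertex $x$, the open cluster $\mathscr{C}_x$ is the set of vertices $y\in\mathscr{V}$ such that there is a path of open edges connecting $x$ and $y$ (in particular $x\in\mathscr{C}_x$). The vertex $x$ is chosen uniformly at random in $\mathscr{V}$, independently of the $\zeta(e)$, and $S = \mathrm{card}(\mathscr{C}_x)$. *)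

theory Defs
  imports "HOL-Probability.Probability"
begin

definition finite_simple_graph :: "'v set \<Rightarrow> 'v set set \<Rightarrow> bool" where
  "finite_simple_graph V E \<longleftrightarrow> finite V \<and> (\<forall>e\<in>E. e \<subseteq> V \<and> card e = 2)"

definition regular_graph :: "'v set \<Rightarrow> 'v set set \<Rightarrow> nat \<Rightarrow> bool" where
  "regular_graph V E D \<longleftrightarrow> (\<forall>v\<in>V. card {e\<in>E. v \<in> e} = D)"

text \<open>A path is given by its nonempty list of pairwise distinct vertices; the singleton
  list \<open>[x]\<close> is the trivial path from \<open>x\<close> to itself.\<close>

definition open_path :: "'v set \<Rightarrow> 'v set set \<Rightarrow> ('v set \<Rightarrow> bool) \<Rightarrow> 'v list \<Rightarrow> bool" where
  "open_path V E z xs \<longleftrightarrow> xs \<noteq> [] \<and> distinct xs \<and> set xs \<subseteq> V \<and>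
     successively (\<lambda>u v. {u, v} \<in> E \<and> z {u, v}) xs"

definition open_cluster :: "'v set \<Rightarrow> 'v set set \<Rightarrow> ('v set \<Rightarrow> bool) \<Rightarrow> 'v \<Rightarrow> 'v set" where
  "open_cluster V E z x = {y \<in> V. \<exists>xs. open_path V E z xs \<and> hd xs = x \<and> last xs = y}"

text \<open>Bernoulli variables are Boolean-valued: \<open>True\<close> (open) stands for 1, \<open>False\<close> (closed)
  for 0. Measurability of the \<open>\<zeta> e\<close> is part of \<open>indep_vars\<close>.\<close>

definition bond_percolation ::
    "'w measure \<Rightarrow> 'v set set \<Rightarrow> real \<Rightarrow> ('v set \<Rightarrow> 'w \<Rightarrow> bool) \<Rightarrow> bool" where
  "bond_percolation M E p \<zeta> \<longleftrightarrow>
     prob_space.indep_vars M (\<lambda>_. count_space UNIV) \<zeta> E \<and>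
     (\<forall>e\<in>E. distr M (count_space UNIV) (\<zeta> e) = measure_pmf (bernoulli_pmf p))"

text \<open>The library's \<open>indep_var\<close> only relates variables with values in the same type, so
  independence of the vertex \<open>X\<close> from the family \<open>\<zeta>\<close> is stated as independence of the
  sigma-algebras that they generate.\<close>

definition independent_uniform_vertex ::
    "'w measure \<Rightarrow> 'v set \<Rightarrow> 'v set set \<Rightarrow> ('v set \<Rightarrow> 'w \<Rightarrow> bool) \<Rightarrow> ('w \<Rightarrow> 'v) \<Rightarrow> bool" where
  "independent_uniform_vertex M V E \<zeta> X \<longleftrightarrow>
     X \<in> measurable M (count_space UNIV) \<and>
     distr M (count_space UNIV) X = measure_pmf (pmf_of_set V) \<and>
     prob_space.indep_set M
       (sets (vimage_algebra (space M) X (count_space UNIV)))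
       (sets (vimage_algebra (space M) (\<lambda>\<omega>. \<lambda>e\<in>E. \<zeta> e \<omega>)
         (PiM E (\<lambda>_. count_space UNIV))))"

definition cluster_size ::
    "'v set \<Rightarrow> 'v set set \<Rightarrow> ('v set \<Rightarrow> 'w \<Rightarrow> bool) \<Rightarrow> ('w \<Rightarrow> 'v) \<Rightarrow> 'w \<Rightarrow> nat" where
  "cluster_size V E \<zeta> X \<omega> = card (open_cluster V E (\<lambda>e. \<zeta> e \<omega>) (X \<omega>))"

end

theory Submission imports Defs begin

text \<open>
  If \<open>y\<close> and \<open>y'\<close> both lie in the open cluster of \<open>x\<close>, then open self-avoiding paths to them can be
  chosen that share an initial stem and are vertex-disjoint afterwards: follow the path to \<open>y'\<close>, and
  cut it at its last visit to the path to \<open>y\<close> (lemma \<open>cluster_pair_open_tripod\<close>). So \<open>S\<^sup>2\<close>, the number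
  of pairs of cluster vertices, is at most the number of open tripods rooted at \<open>x\<close>, where a tripod
  consists of a stem and two disjoint branches leaving its end. A tripod has as many distinct edges
  as it has vertices other than \<open>x\<close>, so it is open with probability \<open>p\<close> to the power of that number.
  In the same way, \<open>S\<close> is at most the number of open self-avoiding paths from \<open>x\<close>. In a
  \<open>D\<close>-regular tree each vertex determines its path from \<open>x\<close> and each pair its tripod, so these union
  bounds are equalities there; the right-hand sides of the theorem are the first two moments, in
  such a tree, of the number of vertices within distance \<open>R\<close> of \<open>x\<close> that open edges join to \<open>x\<close>.

  It remains to bound the sum of the probabilities over all tripods. No path visits a vertex
  twice, so each has at most \<open>R\<close> steps, and each step except the one out of \<open>x\<close> has at most \<open>D - 1\<close>
  choices. Splitting off the first step turns the sums into recursions over the path already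
  explored:
    \<^item> paths extending it have total weight at most a geometric sum
      \<open>G\<^sub>n = 1 + \<nu> + \<dots> + \<nu>\<^sup>n\<^sup>-\<^sup>1\<close> (\<open>extension_weight_le\<close>);
    \<^item> forks at its end have, for \<open>d\<close> possible next vertices, total weight at most
      \<open>1 + 2dpG + d(d-1)(pG)\<^sup>2\<close> (\<open>fork_weight_le\<close>): either both branches are empty, or one is, or they start
      at distinct vertices;
    \<^item> tripods either fork at once or lengthen the stem by one step, which gives
      \<open>(1-p)w\<^sub>n + pG\<^sub>n\<^sup>2\<close> with \<open>w\<^sub>n\<^sub>+\<^sub>1 = G\<^sub>n\<^sub>+\<^sub>1\<^sup>2 + \<nu>w\<^sub>n\<close> (\<open>tripod_weight_le\<close>).

  Evaluating \<open>G\<^sub>R\<close> and \<open>w\<^sub>R\<close> (\<open>gsum R\<close> and \<open>sqsum R\<close>) in closed form yields the stated bounds. Independence of the starting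
  vertex from the edges enters only through the product formula for a single vertex and a single
  set of edges, and averaging bounds that are uniform in \<open>x\<close> preserves them.
\<close>

section \<open>Edges of a path\<close>

fun path_edges :: "'v list \<Rightarrow> 'v set set" where
  "path_edges (u # v # xs) = insert {u, v} (path_edges (v # xs))"
| "path_edges _ = {}"

lemma successively_conv_path_edges:
  "successively (\<lambda>u v. {u, v} \<in> E \<and> z {u, v}) xs \<longleftrightarrow> path_edges xs \<subseteq> {e \<in> E. z e}"
  by (induction xs rule: path_edges.induct) auto

lemma finite_path_edges [simp]: "finite (path_edges xs)"
  by (induction xs rule: path_edges.induct) auto

lemma path_edges_subset: "e \<in> path_edges xs \<Longrightarrow> e \<subseteq> set xs"
  by (induction xs rule: path_edges.induct) auto

text \<open>This makes the edges of a branch distinct from those of any path avoiding the branch.\<close>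

lemma path_edges_meets_tl: "e \<in> path_edges (w # ys) \<Longrightarrow> e \<inter> set ys \<noteq> {}"
  by (induction ys arbitrary: w) auto

lemma path_edges_append:
  "xs \<noteq> [] \<Longrightarrow> path_edges (xs @ ys) = path_edges xs \<union> path_edges (last xs # ys)"
  by (induction xs rule: path_edges.induct) auto

lemma card_path_edges: "distinct xs \<Longrightarrow> card (path_edges xs) = length xs - 1"
proof (induction xs rule: path_edges.induct)
  case (1 u v xs)
  have "{u, v} \<notin> path_edges (v # xs)"
    using 1(2) path_edges_subset[of "{u, v}" "v # xs"] by auto
  with 1 show ?case by simp
qed auto

definition self_avoiding :: "'v set \<Rightarrow> 'v set set \<Rightarrow> 'v list \<Rightarrow> bool" where
  "self_avoiding V E xs \<longleftrightarrow> xs \<noteq> [] \<and> distinct xs \<and> set xs \<subseteq> V \<and> path_edges xs \<subseteq> E"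

lemma open_path_conv_self_avoiding:
  "open_path V E z xs \<longleftrightarrow> self_avoiding V E xs \<and> (\<forall>e\<in>path_edges xs. z e)"
  unfolding open_path_def self_avoiding_def successively_conv_path_edges by auto

lemma self_avoiding_prefix: "self_avoiding V E (xs @ ys) \<Longrightarrow> xs \<noteq> [] \<Longrightarrow> self_avoiding V E xs"
  unfolding self_avoiding_def by (auto simp: path_edges_append)

section \<open>Extensions, forks and tripods\<close>

text \<open>Extensions, forks and tripods are all given relative to a path \<open>\<gamma>\<close> already explored, so that
  splitting off the first step replaces \<open>\<gamma>\<close> by \<open>\<gamma> @ [u]\<close> and the sets become recursive.\<close>

definition extensions :: "'v set \<Rightarrow> 'v set set \<Rightarrow> 'v list \<Rightarrow> 'v list set" where
  "extensions V E \<gamma> = {\<beta>. self_avoiding V E (\<gamma> @ \<beta>)}"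

definition forks :: "'v set \<Rightarrow> 'v set set \<Rightarrow> 'v list \<Rightarrow> ('v list \<times> 'v list) set" where
  "forks V E \<gamma> = {(\<beta>1, \<beta>2). \<beta>1 \<in> extensions V E \<gamma> \<and> \<beta>2 \<in> extensions V E \<gamma> \<and> set \<beta>1 \<inter> set \<beta>2 = {}}"

text \<open>A tripod is a stem \<open>\<alpha>\<close> continuing \<open>\<gamma>\<close> together with a fork at the end of the stem. Stem and
  branches may be empty.\<close>

definition tripods :: "'v set \<Rightarrow> 'v set set \<Rightarrow> 'v list \<Rightarrow> ('v list \<times> 'v list \<times> 'v list) set" where
  "tripods V E \<gamma> = {(\<alpha>, f). f \<in> forks V E (\<gamma> @ \<alpha>)}"

definition next_vertices :: "'v set \<Rightarrow> 'v set set \<Rightarrow> 'v list \<Rightarrow> 'v set" where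
  "next_vertices V E \<gamma> = {u. self_avoiding V E (\<gamma> @ [u])}"

fun tripod_edges :: "'v list \<Rightarrow> 'v list \<times> 'v list \<times> 'v list \<Rightarrow> 'v set set" where
  "tripod_edges \<gamma> (\<alpha>, \<beta>1, \<beta>2) = path_edges (\<gamma> @ \<alpha> @ \<beta>1) \<union> path_edges (\<gamma> @ \<alpha> @ \<beta>2)"

fun tripod_length :: "'v list \<times> 'v list \<times> 'v list \<Rightarrow> nat" where
  "tripod_length (\<alpha>, \<beta>1, \<beta>2) = length \<alpha> + length \<beta>1 + length \<beta>2"

text \<open>Orient the tripod away from its root: every vertex other than \<open>x\<close> then has its own edge towards \<open>x\<close>.
  Formally, the edges of the second branch all meet \<open>\<beta>2\<close>, which the path through \<open>\<beta>1\<close> avoids.\<close>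

lemma card_tripod_edges:
  assumes "\<tau> \<in> tripods V E [x]"
  shows "card (tripod_edges [x] \<tau>) = tripod_length \<tau>"
proof -
  obtain \<alpha> \<beta>1 \<beta>2 where \<tau>: "\<tau> = (\<alpha>, \<beta>1, \<beta>2)" by (cases \<tau>)
  define s where "s = x # \<alpha>"
  have d: "distinct (s @ \<beta>1)" "distinct (s @ \<beta>2)" "set \<beta>1 \<inter> set \<beta>2 = {}" and s: "s \<noteq> []"
    using assms by (auto simp: \<tau> tripods_def forks_def extensions_def self_avoiding_def s_def)
  have eq: "tripod_edges [x] \<tau> = path_edges (s @ \<beta>1) \<union> path_edges (last s # \<beta>2)"
    using s path_edges_append[OF s, of \<beta>1] path_edges_append[OF s, of \<beta>2]
    by (auto simp: \<tau> s_def)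
  have disj: "path_edges (s @ \<beta>1) \<inter> path_edges (last s # \<beta>2) = {}"
  proof (intro equals0I)
    fix e assume "e \<in> path_edges (s @ \<beta>1) \<inter> path_edges (last s # \<beta>2)"
    then have "e \<subseteq> set (s @ \<beta>1)" "e \<inter> set \<beta>2 \<noteq> {}"
      using path_edges_subset path_edges_meets_tl by fast+
    with d show False by auto
  qed
  have "distinct (last s # \<beta>2)"
    using d(2) last_in_set[OF s] by auto
  then have "card (tripod_edges [x] \<tau>) = (length (s @ \<beta>1) - 1) + length \<beta>2"
    using card_path_edges[OF d(1)] card_path_edges[of "last s # \<beta>2"] 
    unfolding eq by (subst card_Un_disjoint) (use disj in auto)
  then show ?thesis by (simp add: \<tau> s_def)
qed

text \<open>The stem ends at the last vertex \<open>w\<close> of the path to \<open>y'\<close> that lies on the path to \<open>y\<close>. The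
  stem and the first branch are the parts of the path to \<open>y\<close> before and after \<open>w\<close>, and what follows \<open>w\<close>
  on the path to \<open>y'\<close> avoids both by the choice of \<open>w\<close>.\<close>

lemma cluster_pair_open_tripod:
  assumes "y \<in> open_cluster V E z x" "y' \<in> open_cluster V E z x"
  shows "\<exists>\<alpha> \<beta>1 \<beta>2. (\<alpha>, \<beta>1, \<beta>2) \<in> tripods V E [x] \<and> (\<forall>e\<in>tripod_edges [x] (\<alpha>, \<beta>1, \<beta>2). z e) \<and>
           y = last (x # \<alpha> @ \<beta>1) \<and> y' = last (x # \<alpha> @ \<beta>2)"
proof -
  obtain xs where xs: "open_path V E z xs" "hd xs = x" "last xs = y"
    using assms(1) by (auto simp: open_cluster_def)
  obtain ys where ys: "open_path V E z ys" "hd ys = x" "last ys = y'"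
    using assms(2) by (auto simp: open_cluster_def)
  have ne: "xs \<noteq> []" "ys \<noteq> []" using xs(1) ys(1) by (auto simp: open_path_def)
  have "\<exists>v\<in>set ys. v \<in> set xs"
    using xs(2) ys(2) ne by (metis hd_in_set)
  \<comment> \<open>The last common vertex, seen along \<open>ys\<close>; its initial part \<open>\<delta>\<close> may cross \<open>xs\<close> and is discarded.\<close>
  then obtain \<delta> w \<beta>2 where w: "ys = \<delta> @ w # \<beta>2" "w \<in> set xs" "\<forall>v\<in>set \<beta>2. v \<notin> set xs"
    using split_list_last_prop[of ys "\<lambda>v. v \<in> set xs"] by blast
  then obtain s' \<beta>1 where s': "xs = s' @ w # \<beta>1"
    by (meson split_list)
  define \<alpha> where "\<alpha> = tl (s' @ [w])"
  have xa: "x # \<alpha> = s' @ [w]"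
    using xs(2) s' by (cases s') (auto simp: \<alpha>_def)
  have la: "last (x # \<alpha>) = w" by (simp add: xa)
  have xs_eq: "xs = x # \<alpha> @ \<beta>1" using xa s' by (metis append_Cons append_Nil append_assoc)
  have pe: "path_edges (x # \<alpha> @ zs) = path_edges (x # \<alpha>) \<union> path_edges (w # zs)" for zs
    using path_edges_append[of "x # \<alpha>" zs] la by simp
  have pys: "path_edges (w # \<beta>2) \<subseteq> path_edges ys"
  proof -
    have "path_edges ((\<delta> @ [w]) @ \<beta>2) = path_edges (\<delta> @ [w]) \<union> path_edges (w # \<beta>2)"
      by (subst path_edges_append) auto
    then show ?thesis using w(1) by simp
  qed
  have sx: "self_avoiding V E xs" "\<forall>e\<in>path_edges xs. z e"
    and sy: "self_avoiding V E ys" "\<forall>e\<in>path_edges ys. z e"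
    using xs(1) ys(1) by (auto simp: open_path_conv_self_avoiding)
  have e2: "path_edges (x # \<alpha> @ \<beta>2) \<subseteq> path_edges xs \<union> path_edges ys"
    using pe[of \<beta>1] pe[of \<beta>2] pys unfolding xs_eq by auto
  have sb: "self_avoiding V E (x # \<alpha> @ \<beta>2)"
    using sx(1) sy(1) e2 w(1,3) unfolding self_avoiding_def by (auto simp: xs_eq)
  have "(\<alpha>, \<beta>1, \<beta>2) \<in> tripods V E [x]"
    using sx(1) sb w(3) by (auto simp: tripods_def forks_def extensions_def xs_eq)
  moreover have "\<forall>e\<in>tripod_edges [x] (\<alpha>, \<beta>1, \<beta>2). z e"
    using sx(2) sy(2) e2 by (auto simp: xs_eq)
  moreover have "y = last (x # \<alpha> @ \<beta>1)" using xs(3) xs_eq by simp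
  moreover have "y' = last (x # \<alpha> @ \<beta>2)"
    using ys(3) la by (auto simp: w(1))
  ultimately show ?thesis by blast
qed

section \<open>Finiteness and degree bounds in a regular graph\<close>

locale regular_simple_graph =
  fixes V :: "'v set" and E :: "'v set set" and D :: nat
  assumes simple: "finite_simple_graph V E" and regular: "regular_graph V E D"
begin

lemma finite_V: "finite V" and finite_E: "finite E"
proof -
  show "finite V" using simple by (simp add: finite_simple_graph_def)
  then show "finite E"
    by (rule rev_finite_subset[OF finite_Pow_iff[THEN iffD2]]) (use simple in \<open>auto simp: finite_simple_graph_def\<close>)
qed

lemma length_self_avoiding_le: "self_avoiding V E xs \<Longrightarrow> length xs \<le> card V"
  unfolding self_avoiding_def using finite_V by (metis card_mono distinct_card)

lemma finite_self_avoiding: "finite {xs. self_avoiding V E xs}"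
  by (rule finite_subset[OF _ finite_lists_length_le[OF finite_V, of "card V"]])
    (auto simp: length_self_avoiding_le, auto simp: self_avoiding_def)

lemma finite_extensions [simp]: "finite (extensions V E \<gamma>)"
  unfolding extensions_def
  by (rule finite_vimageI[OF finite_self_avoiding, unfolded vimage_def, simplified])
    (auto simp: inj_on_def)

lemma finite_forks [simp]: "finite (forks V E \<gamma>)"
  by (rule finite_subset[of _ "extensions V E \<gamma> \<times> extensions V E \<gamma>"]) (auto simp: forks_def)

lemma finite_next_vertices [simp]: "finite (next_vertices V E \<gamma>)"
  by (rule finite_subset[OF _ finite_V]) (auto simp: next_vertices_def self_avoiding_def)

lemma finite_tripods [simp]: 
  assumes "\<gamma> \<noteq> []"
  shows "finite (tripods V E \<gamma>)"
proof -
  have "\<alpha> \<in> extensions V E \<gamma>" if "f \<in> forks V E (\<gamma> @ \<alpha>)" for \<alpha> f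
    using that assms self_avoiding_prefix[of V E "\<gamma> @ \<alpha>"]
    by (auto simp: forks_def extensions_def)
  then have "tripods V E \<gamma> \<subseteq> (SIGMA \<alpha>:extensions V E \<gamma>. forks V E (\<gamma> @ \<alpha>))"
    by (auto simp: tripods_def)
  then show ?thesis by (rule finite_subset) auto
qed

lemma card_neighbours_le: 
  assumes "v \<in> V" "A \<subseteq> {u. {v, u} \<in> E}" 
  shows "card A \<le> D"
proof -
  have "card A \<le> card {e \<in> E. v \<in> e}"
    by (rule card_inj_on_le[of "\<lambda>u. {v, u}"])
      (use assms finite_E in \<open>auto simp: inj_on_def doubleton_eq_iff\<close>)
  also have "\<dots> = D" using regular assms(1) by (simp add: regular_graph_def)
  finally show ?thesis .
qed

lemma next_vertices_neighbours:
  assumes "\<gamma> \<noteq> []"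
  shows "next_vertices V E \<gamma> \<subseteq> {u. {last \<gamma>, u} \<in> E}"
  using assms by (auto simp: next_vertices_def self_avoiding_def path_edges_append)

lemma card_next_vertices_le:
  assumes "self_avoiding V E \<gamma>"
  shows "card (next_vertices V E \<gamma>) \<le> D"
  by (rule card_neighbours_le[of "last \<gamma>"])
    (use assms next_vertices_neighbours in \<open>auto simp: self_avoiding_def\<close>)

text \<open>The predecessor of the end point of \<open>\<gamma>\<close> is a neighbour that a self-avoiding path cannot return to.\<close>

lemma card_next_vertices_less:
  assumes "self_avoiding V E \<gamma>" "2 \<le> length \<gamma>"
  shows "card (next_vertices V E \<gamma>) < D"
proof -
  obtain \<delta> t v where \<gamma>: "\<gamma> = \<delta> @ [t, v]"
  proof -
    have "\<gamma> = butlast (butlast \<gamma>) @ [last (butlast \<gamma>), last \<gamma>]"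
      using assms(2) by (cases \<gamma> rule: rev_cases; cases "butlast \<gamma>" rule: rev_cases)
        (auto simp: butlast_append)
    then show ?thesis using that by blast
  qed
  have t: "{v, t} \<in> E" "v \<in> V"
    using assms(1) path_edges_append[of "\<delta> @ [t]" "[v]"]
    by (auto simp: self_avoiding_def \<gamma> insert_commute)
  have "t \<notin> next_vertices V E \<gamma>"
    by (auto simp: next_vertices_def self_avoiding_def \<gamma>)
  moreover have "card (insert t (next_vertices V E \<gamma>)) \<le> D"
    by (rule card_neighbours_le[of v])
      (use t next_vertices_neighbours[of \<gamma>] in \<open>auto simp: \<gamma>\<close>)
  ultimately show ?thesis by simp
qed

lemma extensions_unfold:
  assumes "self_avoiding V E \<gamma>"
  shows "extensions V E \<gamma> = 
    insert [] (\<Union>u\<in>next_vertices V E \<gamma>. (#) u ` extensions V E (\<gamma> @ [u]))"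
    (is "_ = ?R")
proof (intro equalityI subsetI)
  fix \<beta> assume b: "\<beta> \<in> extensions V E \<gamma>"
  show "\<beta> \<in> ?R"
  proof (cases \<beta>)
    case (Cons u \<beta>')
    then have "self_avoiding V E ((\<gamma> @ [u]) @ \<beta>')" using b by (simp add: extensions_def)
    moreover from this have "self_avoiding V E (\<gamma> @ [u])" by (rule self_avoiding_prefix) simp
    ultimately show ?thesis by (auto simp: Cons next_vertices_def extensions_def)
  qed auto
qed (use assms in \<open>auto simp: extensions_def\<close>)

lemma tripods_unfold:
  assumes "\<gamma> \<noteq> []"
  shows "tripods V E \<gamma> = Pair [] ` forks V E \<gamma> \<union>
    (\<Union>u\<in>next_vertices V E \<gamma>. (\<lambda>(\<alpha>, f). (u # \<alpha>, f)) ` tripods V E (\<gamma> @ [u]))"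
    (is "_ = ?R")
proof (intro equalityI subsetI)
  fix \<tau> assume t: "\<tau> \<in> tripods V E \<gamma>"
  obtain \<alpha> f where \<tau>: "\<tau> = (\<alpha>, f)" by (cases \<tau>)
  show "\<tau> \<in> ?R"
  proof (cases \<alpha>)
    case Nil
    then show ?thesis using t by (auto simp: \<tau> tripods_def)
  next
    case (Cons u \<alpha>')
    have f: "f \<in> forks V E ((\<gamma> @ [u]) @ \<alpha>')" using t by (simp add: \<tau> Cons tripods_def)
    then obtain \<beta>1 where "self_avoiding V E ((\<gamma> @ [u]) @ \<alpha>' @ \<beta>1)"
      by (auto simp: forks_def extensions_def)
    then have "self_avoiding V E (\<gamma> @ [u])" by (rule self_avoiding_prefix) simp
    then have "u \<in> next_vertices V E \<gamma>" by (simp add: next_vertices_def)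
    moreover have "\<tau> \<in> (\<lambda>(\<alpha>, f). (u # \<alpha>, f)) ` tripods V E (\<gamma> @ [u])"
      using f by (intro image_eqI[of _ _ "(\<alpha>', f)"]) (auto simp: \<tau> Cons tripods_def)
    ultimately show ?thesis by blast
  qed
qed (auto simp: tripods_def)

end

section \<open>Total weights of extensions, forks and tripods\<close>

locale percolation_weights = regular_simple_graph V E D
  for V :: "'v set" and E D +
  fixes p \<nu> :: real
  assumes p: "0 < p" "p < 1" and \<nu>: "\<nu> = (real D - 1) * p"
begin

text \<open>A configuration with \<open>k\<close> edges beyond \<open>\<gamma>\<close> gets weight \<open>p ^ k\<close>, the probability that these edges
  are all open.\<close>

definition extension_weight :: "'v list \<Rightarrow> real" where
  "extension_weight \<gamma> = (\<Sum>\<beta>\<in>extensions V E \<gamma>. p ^ length \<beta>)"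

definition fork_weight :: "'v list \<Rightarrow> real" where
  "fork_weight \<gamma> = (\<Sum>(\<beta>1, \<beta>2)\<in>forks V E \<gamma>. p ^ (length \<beta>1 + length \<beta>2))"

definition tripod_weight :: "'v list \<Rightarrow> real" where
  "tripod_weight \<gamma> = (\<Sum>\<tau>\<in>tripods V E \<gamma>. p ^ tripod_length \<tau>)"

lemma extension_weight_nonneg: "0 \<le> extension_weight \<gamma>"
  unfolding extension_weight_def using p by (intro sum_nonneg) auto

lemma sum_nonempty_extensions:
  "(\<Sum>\<beta>\<in>(\<Union>u\<in>next_vertices V E \<gamma>. (#) u ` extensions V E (\<gamma> @ [u])). p ^ length \<beta>) =
     p * (\<Sum>u\<in>next_vertices V E \<gamma>. extension_weight (\<gamma> @ [u]))"
  unfolding extension_weight_def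
  by (subst sum.UNION_disjoint) (auto simp: sum.reindex sum_distrib_left)

lemma extension_weight_unfold:
  assumes "self_avoiding V E \<gamma>"
  shows "extension_weight \<gamma> = 1 + p * (\<Sum>u\<in>next_vertices V E \<gamma>. extension_weight (\<gamma> @ [u]))"
proof -
  have "extension_weight \<gamma> = 
    (\<Sum>\<beta>\<in>insert [] (\<Union>u\<in>next_vertices V E \<gamma>. (#) u ` extensions V E (\<gamma> @ [u])). p ^ length \<beta>)"
    unfolding extension_weight_def extensions_unfold[OF assms] ..
  also have "\<dots> = 1 + p * (\<Sum>u\<in>next_vertices V E \<gamma>. extension_weight (\<gamma> @ [u]))"
    by (subst sum.insert) (auto simp: sum_nonempty_extensions)
  finally show ?thesis .
qed

lemma tripod_weight_unfold:
  assumes "\<gamma> \<noteq> []"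
  shows "tripod_weight \<gamma> = fork_weight \<gamma> + p * (\<Sum>u\<in>next_vertices V E \<gamma>. tripod_weight (\<gamma> @ [u]))"
proof -
  let ?c = "\<lambda>u (\<alpha>, f). (u # \<alpha>, f)"
  have "tripod_weight \<gamma> = (\<Sum>\<tau>\<in>Pair [] ` forks V E \<gamma>. p ^ tripod_length \<tau>) +
      (\<Sum>\<tau>\<in>(\<Union>u\<in>next_vertices V E \<gamma>. ?c u ` tripods V E (\<gamma> @ [u])). p ^ tripod_length \<tau>)"
    unfolding tripod_weight_def tripods_unfold[OF assms]
    by (subst sum.union_disjoint) auto
  also have "(\<Sum>\<tau>\<in>Pair [] ` forks V E \<gamma>. p ^ tripod_length \<tau>) = fork_weight \<gamma>"
    unfolding fork_weight_def by (subst sum.reindex) (auto simp: inj_on_def intro!: sum.cong)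
  also have "(\<Sum>\<tau>\<in>(\<Union>u\<in>next_vertices V E \<gamma>. ?c u ` tripods V E (\<gamma> @ [u])). p ^ tripod_length \<tau>) =
      (\<Sum>u\<in>next_vertices V E \<gamma>. \<Sum>\<tau>\<in>?c u ` tripods V E (\<gamma> @ [u]). p ^ tripod_length \<tau>)"
    by (rule sum.UNION_disjoint) auto
  also have "\<dots> = (\<Sum>u\<in>next_vertices V E \<gamma>. p * tripod_weight (\<gamma> @ [u]))"
  proof (rule sum.cong)
    fix u
    show "(\<Sum>\<tau>\<in>?c u ` tripods V E (\<gamma> @ [u]). p ^ tripod_length \<tau>) = p * tripod_weight (\<gamma> @ [u])"
      unfolding tripod_weight_def
      by (subst sum.reindex) (auto simp: inj_on_def sum_distrib_left intro!: sum.cong)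
  qed simp
  finally show ?thesis by (simp add: sum_distrib_left)
qed

text \<open>A fork has two empty branches, one empty branch, or two branches with distinct first
  vertices \<open>u\<close> and \<open>v\<close>. The inequality comes from forgetting, in the last case, that branches are
  disjoint beyond their first vertices.\<close>

lemma fork_weight_le_unfold:
  assumes "self_avoiding V E \<gamma>"
  defines "Nx \<equiv> next_vertices V E \<gamma>" and "w \<equiv> \<lambda>u. extension_weight (\<gamma> @ [u])"
  shows "fork_weight \<gamma> \<le> 1 + 2 * p * (\<Sum>u\<in>Nx. w u) + p\<^sup>2 * (\<Sum>u\<in>Nx. \<Sum>v\<in>Nx - {u}. w u * w v)"
proof -
  \<comment> \<open>\<open>X u\<close>: branches starting at \<open>u\<close>; \<open>A\<close>: nonempty branches; \<open>P\<close>: pairs with distinct first vertices.\<close>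
  define X where "X u = (#) u ` extensions V E (\<gamma> @ [u])" for u
  define A where "A = (\<Union>u\<in>Nx. X u)"
  define P where "P = (\<Union>u\<in>Nx. \<Union>v\<in>Nx - {u}. X u \<times> X v)"
  let ?h = "\<lambda>(\<beta>1 :: 'v list, \<beta>2 :: 'v list). p ^ (length \<beta>1 + length \<beta>2)"
  have fin [simp]: "finite Nx" "finite (X u)" for u by (simp_all add: Nx_def X_def)
  have ext: "extensions V E \<gamma> = insert [] A"
    unfolding A_def X_def Nx_def by (rule extensions_unfold[OF assms(1)])
  have sA: "(\<Sum>\<beta>\<in>A. p ^ length \<beta>) = p * (\<Sum>u\<in>Nx. w u)"
    unfolding A_def X_def Nx_def w_def by (rule sum_nonempty_extensions)
  have sX: "(\<Sum>\<beta>\<in>X u. p ^ length \<beta>) = p * w u" for u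
    unfolding X_def w_def extension_weight_def by (simp add: sum.reindex sum_distrib_left)
  have sub: "forks V E \<gamma> \<subseteq> {([], [])} \<union> (\<lambda>\<beta>. (\<beta>, [])) ` A \<union> Pair [] ` A \<union> P"
  proof
    fix f assume f: "f \<in> forks V E \<gamma>"
    obtain \<beta>1 \<beta>2 where "f = (\<beta>1, \<beta>2)" by (cases f)
    with f show "f \<in> {([], [])} \<union> (\<lambda>\<beta>. (\<beta>, [])) ` A \<union> Pair [] ` A \<union> P"
      unfolding forks_def ext by (fastforce simp: A_def P_def X_def)
  qed
  have finA: "finite A" and finP: "finite P" by (simp_all add: A_def P_def)
  have "fork_weight \<gamma> \<le> sum ?h ({([], [])} \<union> (\<lambda>\<beta>. (\<beta>, [])) ` A \<union> Pair [] ` A \<union> P)"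
    unfolding fork_weight_def using sub finA finP p by (intro sum_mono2) auto
  also have "\<dots> = 1 + p * (\<Sum>u\<in>Nx. w u) + p * (\<Sum>u\<in>Nx. w u) + sum ?h P"
  proof -
    have ne: "[] \<notin> A" "([], x) \<notin> P" "(x, []) \<notin> P" for x by (auto simp: A_def P_def X_def)
    have "sum ?h ({([], [])} \<union> (\<lambda>\<beta>. (\<beta>, [])) ` A \<union> Pair [] ` A \<union> P) =
        sum ?h {([], [])} + sum ?h ((\<lambda>\<beta>. (\<beta>, [])) ` A) + sum ?h (Pair [] ` A) + sum ?h P"
      using finA finP ne by (subst sum.union_disjoint; (auto; fail)?)+
    moreover have "sum ?h ((\<lambda>\<beta>. (\<beta>, [])) ` A) = (\<Sum>\<beta>\<in>A. p ^ length \<beta>)"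
      by (subst sum.reindex) (auto simp: inj_on_def)
    moreover have "sum ?h (Pair [] ` A) = (\<Sum>\<beta>\<in>A. p ^ length \<beta>)"
      by (subst sum.reindex) (auto simp: inj_on_def)
    ultimately show ?thesis by (simp add: sA)
  qed
  also have "sum ?h P = (\<Sum>u\<in>Nx. \<Sum>v\<in>Nx - {u}. sum ?h (X u \<times> X v))"
  proof -
    have "sum ?h P = (\<Sum>u\<in>Nx. sum ?h (\<Union>v\<in>Nx - {u}. X u \<times> X v))"
      unfolding P_def by (rule sum.UNION_disjoint) (auto simp: X_def)
    also have "\<dots> = (\<Sum>u\<in>Nx. \<Sum>v\<in>Nx - {u}. sum ?h (X u \<times> X v))"
      by (intro sum.cong refl sum.UNION_disjoint) (auto simp: X_def)
    finally show ?thesis .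
  qed
  also have "\<dots> = (\<Sum>u\<in>Nx. \<Sum>v\<in>Nx - {u}. p\<^sup>2 * (w u * w v))"
  proof (intro sum.cong refl)
    fix u v
    have "sum ?h (X u \<times> X v) = (\<Sum>\<beta>1\<in>X u. p ^ length \<beta>1) * (\<Sum>\<beta>2\<in>X v. p ^ length \<beta>2)"
      by (simp add: sum_product sum.cartesian_product power_add)
    then show "sum ?h (X u \<times> X v) = p\<^sup>2 * (w u * w v)"
      by (simp add: sX power2_eq_square mult_ac)
  qed
  also have "\<dots> = p\<^sup>2 * (\<Sum>u\<in>Nx. \<Sum>v\<in>Nx - {u}. w u * w v)"
    by (simp add: sum_distrib_left)
  finally show ?thesis by simp
qed

lemma fork_weight_le:
  assumes sa: "self_avoiding V E \<gamma>" and d: "card (next_vertices V E \<gamma>) \<le> d"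
    and g: "\<And>u. u \<in> next_vertices V E \<gamma> \<Longrightarrow> extension_weight (\<gamma> @ [u]) \<le> g" and g0: "0 \<le> g"
  shows "fork_weight \<gamma> \<le> 1 + 2 * (real d * p * g) + real d * (real d - 1) * (p * g)\<^sup>2"
proof -
  define Nx where "Nx = next_vertices V E \<gamma>"
  define w where "w = (\<lambda>u. extension_weight (\<gamma> @ [u]))"
  define k where "k = card Nx"
  have kd: "k \<le> d" using d by (simp add: k_def Nx_def)
  have fin: "finite Nx" by (simp add: Nx_def)
  have wg: "w u \<le> g" "0 \<le> w u" if "u \<in> Nx" for u
    using g that extension_weight_nonneg by (auto simp: Nx_def w_def)
  have "(\<Sum>u\<in>Nx. w u) \<le> real k * g"
    using sum_bounded_above[of Nx w g] wg by (simp add: k_def)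
  also have "\<dots> \<le> real d * g" using kd g0 by (intro mult_right_mono) auto
  finally have s1: "(\<Sum>u\<in>Nx. w u) \<le> real d * g" .
  have "(\<Sum>u\<in>Nx. \<Sum>v\<in>Nx - {u}. w u * w v) \<le> (\<Sum>u\<in>Nx. \<Sum>v\<in>Nx - {u}. g * g)"
    by (intro sum_mono mult_mono) (use wg g0 in auto)
  also have "\<dots> = real (k * (k - 1)) * (g * g)"
    using fin by (simp add: k_def)
  also have "\<dots> \<le> real (d * (d - 1)) * (g * g)"
    using kd g0 by (intro mult_right_mono of_nat_mono mult_le_mono) auto
  also have "real (d * (d - 1)) = real d * (real d - 1)"
    by (cases d) (auto simp: algebra_simps)
  finally have s2: "(\<Sum>u\<in>Nx. \<Sum>v\<in>Nx - {u}. w u * w v) \<le> real d * (real d - 1) * (g * g)" .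
  have "fork_weight \<gamma> \<le> 1 + 2 * p * (\<Sum>u\<in>Nx. w u) + p\<^sup>2 * (\<Sum>u\<in>Nx. \<Sum>v\<in>Nx - {u}. w u * w v)"
    unfolding Nx_def w_def by (rule fork_weight_le_unfold[OF sa])
  also have "\<dots> \<le> 1 + 2 * p * (real d * g) + p\<^sup>2 * (real d * (real d - 1) * (g * g))"
    using s1 s2 p by (intro add_mono mult_left_mono) auto
  finally show ?thesis by (simp add: power2_eq_square algebra_simps)
qed

text \<open>For \<open>D \<ge> 1\<close>, \<open>gsum n\<close> is the mean number of vertices at depth less than \<open>n\<close> that open edges join to
  the root of a tree in which each vertex has \<open>D - 1\<close> children. In general, \<open>sqsum n\<close> is the sum of
  \<open>\<nu> ^ j * (gsum (n - j))\<^sup>2\<close> over \<open>j < n\<close>, in the form in which the recursion for tripods produces it.\<close>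

definition gsum :: "nat \<Rightarrow> real" where "gsum n = (\<Sum>i<n. \<nu> ^ i)"

primrec sqsum :: "nat \<Rightarrow> real" where
  "sqsum 0 = 0"
| "sqsum (Suc n) = (gsum (Suc n))\<^sup>2 + \<nu> * sqsum n"

lemma gsum_Suc: "gsum (Suc n) = 1 + \<nu> * gsum n"
  unfolding gsum_def by (subst sum.lessThan_Suc_shift) (simp add: sum_distrib_left)

lemma p_mult_branching: "p * ((real D - 1) * g) = \<nu> * g"
  by (simp add: \<nu>)

lemma \<nu>_nonneg: "1 \<le> D \<Longrightarrow> 0 \<le> \<nu>" using \<nu> p by simp

lemma gsum_nonneg: "1 \<le> D \<Longrightarrow> 0 \<le> gsum n"
  unfolding gsum_def using \<nu>_nonneg by (intro sum_nonneg) auto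

lemma sqsum_nonneg: "1 \<le> D \<Longrightarrow> 0 \<le> sqsum n"
  by (induction n) (use \<nu>_nonneg in auto)

text \<open>Since \<open>gsum (Suc n) = 1 + \<nu> * gsum n\<close>, each further step costs a factor \<open>\<nu>\<close>. The recursion ends
  because a path has at most \<open>card V\<close> vertices: then \<open>\<gamma>\<close> has no proper extension.\<close>

lemma extension_weight_le:
  assumes "self_avoiding V E \<gamma>" "2 \<le> length \<gamma>"
  shows "extension_weight \<gamma> \<le> gsum (card V + 1 - length \<gamma>)"
  using assms
proof (induction "card V - length \<gamma>" arbitrary: \<gamma> rule: less_induct)
  case less
  note k = card_next_vertices_less[OF less.prems]
  have D: "1 \<le> D" using k by simp
  have len: "length \<gamma> \<le> card V" by (rule length_self_avoiding_le) fact
  have "extension_weight (\<gamma> @ [u]) \<le> gsum (card V - length \<gamma>)" if "u \<in> next_vertices V E \<gamma>" for u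
  proof -
    have sa: "self_avoiding V E (\<gamma> @ [u])" using that by (simp add: next_vertices_def)
    show ?thesis using less.hyps[OF _ sa] length_self_avoiding_le[OF sa] less.prems by simp
  qed
  then have "(\<Sum>u\<in>next_vertices V E \<gamma>. extension_weight (\<gamma> @ [u])) \<le>
      real (card (next_vertices V E \<gamma>)) * gsum (card V - length \<gamma>)"
    by (rule sum_bounded_above)
  also have "\<dots> \<le> (real D - 1) * gsum (card V - length \<gamma>)"
    using k gsum_nonneg[OF D] by (intro mult_right_mono) auto
  finally have "extension_weight \<gamma> \<le> 1 + p * ((real D - 1) * gsum (card V - length \<gamma>))"
    using p by (simp add: extension_weight_unfold[OF less.prems(1)])
  also have "\<dots> = gsum (Suc (card V - length \<gamma>))" by (simp add: gsum_Suc p_mult_branching)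
  finally show ?case using len by (simp add: Suc_diff_le)
qed

text \<open>Only the first step has up to \<open>D\<close> choices, which is why it is separated from the induction. For
  \<open>D = 0\<close> there is no first step at all.\<close>

lemma extension_weight_singleton_le:
  assumes "x \<in> V"
  shows "extension_weight [x] \<le> 1 + real D * p * gsum (card V - 1)"
proof -
  have sa: "self_avoiding V E [x]" using assms by (simp add: self_avoiding_def)
  have "(\<Sum>u\<in>next_vertices V E [x]. extension_weight ([x] @ [u])) \<le> 
      real (card (next_vertices V E [x])) * gsum (card V - 1)"
    by (rule sum_bounded_above)
      (use extension_weight_le[of "[x, _]"] in \<open>auto simp: next_vertices_def\<close>)
  also have "\<dots> \<le> real D * gsum (card V - 1)"
    using card_next_vertices_le[OF sa] gsum_nonneg by (cases "D = 0") (auto intro!: mult_right_mono)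
  finally show ?thesis
    using p by (simp add: extension_weight_unfold[OF sa] mult_ac)
qed

text \<open>Write \<open>m = n - 1\<close>. With \<open>D - 1\<close> possible next vertices the fork bound is
  \<open>(1 + \<nu> * gsum m)\<^sup>2 - \<nu> * p * (gsum m)\<^sup>2\<close>, whose first term is \<open>(gsum n)\<^sup>2\<close>. Lengthening the stem
  contributes \<open>\<nu>\<close> times the bound for \<open>m\<close>, in which \<open>\<nu> * p * (gsum m)\<^sup>2\<close> appears with the opposite
  sign. The two cancel, which explains the shape of the bound.\<close>

lemma tripod_weight_le:
  assumes "self_avoiding V E \<gamma>" "2 \<le> length \<gamma>"
  defines "n \<equiv> card V + 1 - length \<gamma>"
  shows "tripod_weight \<gamma> \<le> (1 - p) * sqsum n + p * (gsum n)\<^sup>2"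
  using assms(1,2) unfolding n_def
proof (induction "card V - length \<gamma>" arbitrary: \<gamma> rule: less_induct)
  case less
  define m where "m = card V - length \<gamma>"
  note k = card_next_vertices_less[OF less.prems]
  have D: "1 \<le> D" using k by simp
  have len: "length \<gamma> \<le> card V" by (rule length_self_avoiding_le) fact
  have m1: "card V + 1 - length \<gamma> = Suc m" using len by (simp add: m_def)
  define y where "y = (1 - p) * sqsum m + p * (gsum m)\<^sup>2"
  have y0: "0 \<le> y" using p sqsum_nonneg[OF D] by (simp add: y_def)
  have next_le: "tripod_weight (\<gamma> @ [u]) \<le> y" "extension_weight (\<gamma> @ [u]) \<le> gsum m" 
    if "u \<in> next_vertices V E \<gamma>" for u
  proof -
    have sa: "self_avoiding V E (\<gamma> @ [u])" using that by (simp add: next_vertices_def)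
    show "tripod_weight (\<gamma> @ [u]) \<le> y"
      using less.hyps[OF _ sa] length_self_avoiding_le[OF sa] less.prems by (simp add: m_def y_def)
    show "extension_weight (\<gamma> @ [u]) \<le> gsum m"
      using extension_weight_le[OF sa] less.prems by (simp add: m_def)
  qed
  have "(\<Sum>u\<in>next_vertices V E \<gamma>. tripod_weight (\<gamma> @ [u])) \<le> real (card (next_vertices V E \<gamma>)) * y"
    using next_le(1) by (rule sum_bounded_above)
  also have "\<dots> \<le> (real D - 1) * y"
    using k y0 by (intro mult_right_mono) auto
  finally have stem: "p * (\<Sum>u\<in>next_vertices V E \<gamma>. tripod_weight (\<gamma> @ [u])) \<le> p * ((real D - 1) * y)"
    using p by (intro mult_left_mono) auto
  have "fork_weight \<gamma> \<le> 1 + 2 * (real (D - 1) * p * gsum m) + real (D - 1) * (real (D - 1) - 1) * (p * gsum m)\<^sup>2"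
    by (rule fork_weight_le) (use less.prems k next_le(2) gsum_nonneg[OF D] in auto)
  also have "\<dots> = (gsum (Suc m))\<^sup>2 - \<nu> * p * (gsum m)\<^sup>2"
  proof -
    have "1 + 2 * ((real D - 1) * p * g) + (real D - 1) * (real D - 1 - 1) * (p * g)\<^sup>2 =
        (1 + \<nu> * g)\<^sup>2 - \<nu> * p * g\<^sup>2" for g
      unfolding \<nu> by algebra
    then show ?thesis using D unfolding gsum_Suc by (simp only: of_nat_diff of_nat_1)
  qed
  finally have "tripod_weight \<gamma> \<le> (gsum (Suc m))\<^sup>2 - \<nu> * p * (gsum m)\<^sup>2 + p * ((real D - 1) * y)"
    using less.prems stem by (subst tripod_weight_unfold) auto
  also have "\<dots> = (1 - p) * sqsum (Suc m) + p * (gsum (Suc m))\<^sup>2"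
    unfolding p_mult_branching by (simp add: y_def algebra_simps)
  finally show ?case unfolding m1 .
qed

text \<open>The root differs from later vertices only in having \<open>D\<close> instead of \<open>D - 1\<close> possible next vertices.
  The coefficients of \<open>(p * gsum R)\<^sup>2\<close>, namely \<open>D * (D - 1)\<close> from the fork at the root and \<open>D\<close> from the
  longer stems, add up to \<open>D\<^sup>2\<close> and complete the square.\<close>

lemma tripod_weight_singleton_le:
  assumes "x \<in> V"
  defines "R \<equiv> card V - 1"
  shows "tripod_weight [x] \<le> (1 + real D * p * gsum R)\<^sup>2 + real D * p * (1 - p) * sqsum R"
proof -
  have sa: "self_avoiding V E [x]" using assms by (simp add: self_avoiding_def)
  define y where "y = (1 - p) * sqsum R + p * (gsum R)\<^sup>2"
  have next_le: "tripod_weight ([x] @ [u]) \<le> y" "extension_weight ([x] @ [u]) \<le> gsum R" 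
    if "u \<in> next_vertices V E [x]" for u
    using that tripod_weight_le[of "[x, u]"] extension_weight_le[of "[x, u]"]
    by (auto simp: next_vertices_def y_def R_def)
  have "(\<Sum>u\<in>next_vertices V E [x]. tripod_weight ([x] @ [u])) \<le> real (card (next_vertices V E [x])) * y"
    using next_le(1) by (rule sum_bounded_above)
  also have "\<dots> \<le> real D * y"
  proof (cases "D = 0")
    case False
    then have "0 \<le> y" using p sqsum_nonneg by (simp add: y_def)
    then show ?thesis using card_next_vertices_le[OF sa] by (intro mult_right_mono) auto
  qed (use card_next_vertices_le[OF sa] in simp)
  finally have stem: "p * (\<Sum>u\<in>next_vertices V E [x]. tripod_weight ([x] @ [u])) \<le> p * (real D * y)"
    using p by (intro mult_left_mono) auto
  have fork: "fork_weight [x] \<le> 1 + 2 * (real D * p * gsum R) + real D * (real D - 1) * (p * gsum R)\<^sup>2"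
  proof (cases "D = 0")
    case True
    then have "next_vertices V E [x] = {}" using card_next_vertices_le[OF sa] by simp
    then show ?thesis using fork_weight_le[OF sa, of 0 0] True by simp
  next
    case False
    then show ?thesis
      by (intro fork_weight_le[OF sa]) (use card_next_vertices_le[OF sa] next_le(2) gsum_nonneg in auto)
  qed
  have "tripod_weight [x] \<le> 
      1 + 2 * (real D * p * gsum R) + real D * (real D - 1) * (p * gsum R)\<^sup>2 + p * (real D * y)"
    using stem fork by (subst tripod_weight_unfold) auto
  also have "\<dots> = (1 + real D * p * gsum R)\<^sup>2 + real D * p * (1 - p) * sqsum R"
    unfolding y_def by algebra
  finally show ?thesis .
qed

section \<open>Closed forms of the weight bounds\<close>

lemma gsum_closed: "\<nu> \<noteq> 1 \<Longrightarrow> gsum n = (1 - \<nu> ^ n) / (1 - \<nu>)"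
  unfolding gsum_def by (simp add: sum_gp_strict)

lemma sqsum_closed:
  assumes "\<nu> \<noteq> 1"
  shows "sqsum n = ((1 - \<nu> ^ n) * (1 + \<nu> ^ (n + 1)) / (1 - \<nu>) - 2 * real n * \<nu> ^ n) / (1 - \<nu>)\<^sup>2"
proof -
  \<comment> \<open>Clearing denominators turns the induction step into a polynomial identity in \<open>\<nu>\<close>, \<open>\<nu> ^ n\<close> and \<open>n\<close>.\<close>
  have "(1 - \<nu>) ^ 3 * sqsum n = (1 - \<nu> ^ n) * (1 + \<nu> ^ (n + 1)) - 2 * real n * (1 - \<nu>) * \<nu> ^ n"
  proof (induction n)
    case (Suc n)
    have "(1 - \<nu>) * gsum (Suc n) = 1 - \<nu> * \<nu> ^ n" using assms by (simp add: gsum_closed)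
    moreover have "(1 - \<nu>) ^ 3 * sqsum (Suc n) = (1 - \<nu>) * ((1 - \<nu>) * gsum (Suc n))\<^sup>2 + \<nu> * ((1 - \<nu>) ^ 3 * sqsum n)"
      by (simp add: algebra_simps power2_eq_square power3_eq_cube)
    moreover have "(1 - \<nu>) * (1 - \<nu> * t)\<^sup>2 + \<nu> * ((1 - t) * (1 + \<nu> * t) - 2 * s * (1 - \<nu>) * t) =
        (1 - \<nu> * t) * (1 + \<nu> * (\<nu> * t)) - 2 * (1 + s) * (1 - \<nu>) * (\<nu> * t)" for s t :: real
      by algebra
    ultimately show ?case
      using Suc by simp
  qed simp
  moreover have "(1 - \<nu>) \<noteq> 0" using assms by simp
  ultimately have "sqsum n = ((1 - \<nu> ^ n) * (1 + \<nu> ^ (n + 1)) - 2 * real n * (1 - \<nu>) * \<nu> ^ n) / (1 - \<nu>) ^ 3"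
    by (simp add: field_simps)
  also have "\<dots> = ((1 - \<nu> ^ n) * (1 + \<nu> ^ (n + 1)) / (1 - \<nu>) - 2 * real n * \<nu> ^ n) / (1 - \<nu>)\<^sup>2"
  proof -
    have "(a - 2 * r * c * t) / c ^ 3 = (a / c - 2 * r * t) / c\<^sup>2" if "c \<noteq> 0" for a c r t :: real
      using that by (simp add: divide_simps power2_eq_square power3_eq_cube)
    then show ?thesis using \<open>(1 - \<nu>) \<noteq> 0\<close> .
  qed
  finally show ?thesis .
qed

end
section \<open>From edge weights to expectations\<close>

context prob_space
begin

lemma prob_all_open:
  assumes perc: "bond_percolation M E p \<zeta>" and p: "0 \<le> p" "p \<le> 1" and F: "finite F" "F \<subseteq> E"
  shows "prob {\<omega> \<in> space M. \<forall>e\<in>F. \<zeta> e \<omega>} = p ^ card F"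
proof (cases "F = {}")
  case True
  then show ?thesis by (simp add: prob_space)
next
  case False
  have indep: "indep_vars (\<lambda>_. count_space UNIV) \<zeta> E"
    and distr: "\<And>e. e \<in> E \<Longrightarrow> distr M (count_space UNIV) (\<zeta> e) = measure_pmf (bernoulli_pmf p)"
    using perc by (auto simp: bond_percolation_def)
  have edge: "prob (\<zeta> e -` {True} \<inter> space M) = p" if "e \<in> E" for e
  proof -
    have "random_variable (count_space UNIV) (\<zeta> e)"
      using indep that by (auto simp: indep_vars_def)
    then have "prob (\<zeta> e -` {True} \<inter> space M) = measure (distr M (count_space UNIV) (\<zeta> e)) {True}"
      by (subst measure_distr) auto
    also have "\<dots> = p" using p by (simp add: distr[OF that] measure_pmf_single)
    finally show ?thesis .
  qed
  have "{\<omega> \<in> space M. \<forall>e\<in>F. \<zeta> e \<omega>} = (\<Inter>e\<in>F. \<zeta> e -` {True} \<inter> space M)"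
    using False by auto
  also have "prob \<dots> = (\<Prod>e\<in>F. prob (\<zeta> e -` {True} \<inter> space M))"
    using False F by (intro indep_varsD[OF indep]) auto
  also have "\<dots> = p ^ card F"
    using F(2) edge by (simp add: subset_iff)
  finally show ?thesis .
qed

text \<open>Both events belong to the sigma-algebras whose independence is assumed: the first to the one
  generated by \<open>X\<close>, the second to the one generated by the family of all edges in \<open>E\<close>.\<close>

lemma prob_vertex_all_open:
  assumes perc: "bond_percolation M E p \<zeta>" and p: "0 \<le> p" "p \<le> 1" and F: "F \<subseteq> E"
    and fin: "finite E" "finite V"
    and vertex: "independent_uniform_vertex M V E \<zeta> X" and x: "x \<in> V"
  shows "{\<omega> \<in> space M. X \<omega> = x \<and> (\<forall>e\<in>F. \<zeta> e \<omega>)} \<in> events"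
    and "prob {\<omega> \<in> space M. X \<omega> = x \<and> (\<forall>e\<in>F. \<zeta> e \<omega>)} = p ^ card F / card V"
proof -
  have X [measurable]: "X \<in> measurable M (count_space UNIV)"
    and dX: "distr M (count_space UNIV) X = measure_pmf (pmf_of_set V)"
    and ind: "indep_set
       (sets (vimage_algebra (space M) X (count_space UNIV)))
       (sets (vimage_algebra (space M) (\<lambda>\<omega>. \<lambda>e\<in>E. \<zeta> e \<omega>) (PiM E (\<lambda>_. count_space UNIV))))"
    using vertex by (auto simp: independent_uniform_vertex_def)
  have finF: "finite F" using F fin(1) by (rule finite_subset)
  let ?A = "X -` {x} \<inter> space M" and ?B = "{\<omega> \<in> space M. \<forall>e\<in>F. \<zeta> e \<omega>}"
  have A: "?A \<in> sets (vimage_algebra (space M) X (count_space UNIV))"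
    by (rule in_vimage_algebra) simp
  have "{f \<in> space (PiM E (\<lambda>_. count_space UNIV)). \<forall>e\<in>F. f e} \<in> sets (PiM E (\<lambda>_. count_space (UNIV :: bool set)))"
    using finF by measurable (use F in auto)
  then have "(\<lambda>\<omega>. \<lambda>e\<in>E. \<zeta> e \<omega>) -` {f \<in> space (PiM E (\<lambda>_. count_space UNIV)). \<forall>e\<in>F. f e} \<inter> space M
      \<in> sets (vimage_algebra (space M) (\<lambda>\<omega>. \<lambda>e\<in>E. \<zeta> e \<omega>) (PiM E (\<lambda>_. count_space UNIV)))"
    by (rule in_vimage_algebra)
  also have "(\<lambda>\<omega>. \<lambda>e\<in>E. \<zeta> e \<omega>) -` {f \<in> space (PiM E (\<lambda>_. count_space UNIV)). \<forall>e\<in>F. f e} \<inter> space M = ?B"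
    using F by (auto simp: space_PiM)
  finally have B: "?B \<in> sets (vimage_algebra (space M) (\<lambda>\<omega>. \<lambda>e\<in>E. \<zeta> e \<omega>) (PiM E (\<lambda>_. count_space UNIV)))" .
  have eq: "{\<omega> \<in> space M. X \<omega> = x \<and> (\<forall>e\<in>F. \<zeta> e \<omega>)} = ?A \<inter> ?B" by auto
  have "?A \<in> events" by measurable
  moreover have "?B \<in> events" using ind B by (auto simp: indep_set_def indep_sets_def split: bool.splits)
  ultimately show "{\<omega> \<in> space M. X \<omega> = x \<and> (\<forall>e\<in>F. \<zeta> e \<omega>)} \<in> events" unfolding eq by simp
  have "prob ?A = measure (distr M (count_space UNIV) X) {x}"
    by (subst measure_distr) auto
  also have "\<dots> = 1 / card V"
    using x fin(2) by (subst dX, subst measure_pmf_single, subst pmf_of_set) auto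
  finally have "prob ?A = 1 / card V" .
  moreover have "prob (?A \<inter> ?B) = prob ?A * prob ?B"
    using ind A B by (rule indep_setD)
  ultimately show "prob {\<omega> \<in> space M. X \<omega> = x \<and> (\<forall>e\<in>F. \<zeta> e \<omega>)} = p ^ card F / card V"
    unfolding eq prob_all_open[OF perc p finF F] by simp
qed

text \<open>A union bound in expectation: \<open>f\<close> is dominated by the number of configurations \<open>\<tau>\<close> at the vertex \<open>X\<close>
  whose edges \<open>F x \<tau>\<close> are all open. A bound on their total weight that is uniform in the vertex
  survives averaging over \<open>X\<close>. Only the dominating count, a finite sum of indicators, has to be
  integrable. As \<open>X\<close> may leave \<open>V\<close> on a null set, \<open>f\<close> is required to vanish there.\<close>

lemma expectation_le_sum_edge_weights:
  fixes f :: "'a \<Rightarrow> real" and T :: "'v \<Rightarrow> 't set" and F :: "'v \<Rightarrow> 't \<Rightarrow> 'v set set"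
  assumes perc: "bond_percolation M E p \<zeta>" and p: "0 \<le> p" "p \<le> 1"
    and fin: "finite E" "finite V" "V \<noteq> {}"
    and vertex: "independent_uniform_vertex M V E \<zeta> X"
    and T: "\<And>x. x \<in> V \<Longrightarrow> finite (T x)"
    and F: "\<And>x \<tau>. x \<in> V \<Longrightarrow> \<tau> \<in> T x \<Longrightarrow> F x \<tau> \<subseteq> E"
    and f0: "\<And>\<omega>. 0 \<le> f \<omega>" 
    and f_outside: "\<And>\<omega>. X \<omega> \<notin> V \<Longrightarrow> f \<omega> = 0"
    and f_le: "\<And>\<omega>. X \<omega> \<in> V \<Longrightarrow> f \<omega> \<le> card {\<tau> \<in> T (X \<omega>). \<forall>e\<in>F (X \<omega>) \<tau>. \<zeta> e \<omega>}"
    and bound: "\<And>x. x \<in> V \<Longrightarrow> (\<Sum>\<tau>\<in>T x. p ^ card (F x \<tau>)) \<le> b"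
  shows "expectation f \<le> b"
proof -
  define A where "A x \<tau> = {\<omega> \<in> space M. X \<omega> = x \<and> (\<forall>e\<in>F x \<tau>. \<zeta> e \<omega>)}" for x \<tau>
  define h where "h \<omega> = (\<Sum>x\<in>V. \<Sum>\<tau>\<in>T x. indicator (A x \<tau>) \<omega> :: real)" for \<omega>
  have ev: "A x \<tau> \<in> events" and pr: "prob (A x \<tau>) = p ^ card (F x \<tau>) / card V"
    if "x \<in> V" "\<tau> \<in> T x" for x \<tau>
    unfolding A_def using prob_vertex_all_open[OF perc p F[OF that] fin(1,2) vertex that(1)] by auto
  have int: "integrable M (indicator (A x \<tau>) :: _ \<Rightarrow> real)" if "x \<in> V" "\<tau> \<in> T x" for x \<tau>
    using ev[OF that] by (simp add: emeasure_eq_measure)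
  have "f \<omega> \<le> h \<omega>" if w: "\<omega> \<in> space M" for \<omega>
  proof (cases "X \<omega> \<in> V")
    case True
    have "real (card {\<tau> \<in> T (X \<omega>). \<forall>e\<in>F (X \<omega>) \<tau>. \<zeta> e \<omega>}) =
        (\<Sum>\<tau>\<in>T (X \<omega>). indicator (A (X \<omega>) \<tau>) \<omega>)"
      using w T[OF True] by (simp add: A_def indicator_def sum.If_cases Int_def)
    also have "\<dots> \<le> h \<omega>"
      unfolding h_def using fin(2) True by (intro member_le_sum sum_nonneg) auto
    finally show ?thesis using f_le[OF True] by linarith
  next
    case False
    then show ?thesis by (simp add: f_outside h_def sum_nonneg)
  qed
  then have "expectation f \<le> expectation h"
    unfolding h_def by (intro integral_mono') (auto intro!: integrable_sum int f0 sum_nonneg)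
  also have "\<dots> = (\<Sum>x\<in>V. \<Sum>\<tau>\<in>T x. prob (A x \<tau>))"
    unfolding h_def using int ev
    by (simp add: emeasure_eq_measure)

  also have "\<dots> = (\<Sum>x\<in>V. (\<Sum>\<tau>\<in>T x. p ^ card (F x \<tau>)) / card V)"
    using pr by (simp add: sum_divide_distrib)
  also have "\<dots> \<le> (\<Sum>x\<in>V. b / card V)"
    using bound by (intro sum_mono divide_right_mono) auto
  also have "\<dots> = b" using fin by simp
  finally show ?thesis .
qed

end

section \<open>Moments of the cluster size\<close>

text \<open>Paths stay in \<open>V\<close>, so not even the trivial path starts at a vertex outside.\<close>

lemma open_cluster_outside: "x \<notin> V \<Longrightarrow> open_cluster V E z x = {}"
  by (auto simp: open_cluster_def open_path_def) (metis hd_in_set subsetD)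

context regular_simple_graph
begin

lemma card_open_cluster_le:
  "card (open_cluster V E z x) \<le> card {\<beta> \<in> extensions V E [x]. \<forall>e\<in>path_edges (x # \<beta>). z e}"
proof (rule surj_card_le)
  show "open_cluster V E z x \<subseteq> (\<lambda>\<beta>. last (x # \<beta>)) ` {\<beta> \<in> extensions V E [x]. \<forall>e\<in>path_edges (x # \<beta>). z e}"
  proof
    fix y assume "y \<in> open_cluster V E z x"
    then obtain xs where xs: "open_path V E z xs" "hd xs = x" "last xs = y"
      by (auto simp: open_cluster_def)
    then have "xs = x # tl xs" by (auto simp: open_path_def)
    with xs show "y \<in> (\<lambda>\<beta>. last (x # \<beta>)) ` {\<beta> \<in> extensions V E [x]. \<forall>e\<in>path_edges (x # \<beta>). z e}"
      by (intro image_eqI[of _ _ "tl xs"]) (auto simp: open_path_conv_self_avoiding extensions_def)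
  qed
qed simp

text \<open>The left-hand side counts pairs of cluster vertices, and every pair consists of the end points of
  some open tripod.\<close>

lemma card_open_cluster_square_le:
  "(card (open_cluster V E z x))\<^sup>2 \<le> card {\<tau> \<in> tripods V E [x]. \<forall>e\<in>tripod_edges [x] \<tau>. z e}"
proof -
  let ?C = "open_cluster V E z x"
  have "card (?C \<times> ?C) \<le> card {\<tau> \<in> tripods V E [x]. \<forall>e\<in>tripod_edges [x] \<tau>. z e}"
  proof (rule surj_card_le)
    show "?C \<times> ?C \<subseteq> (\<lambda>(\<alpha>, \<beta>1, \<beta>2). (last (x # \<alpha> @ \<beta>1), last (x # \<alpha> @ \<beta>2))) ` 
        {\<tau> \<in> tripods V E [x]. \<forall>e\<in>tripod_edges [x] \<tau>. z e}"
    proof clarify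
      fix y y' assume "y \<in> ?C" "y' \<in> ?C"
      from cluster_pair_open_tripod[OF this] obtain \<alpha> \<beta>1 \<beta>2 where
        "(\<alpha>, \<beta>1, \<beta>2) \<in> tripods V E [x]" "\<forall>e\<in>tripod_edges [x] (\<alpha>, \<beta>1, \<beta>2). z e"
        "y = last (x # \<alpha> @ \<beta>1)" "y' = last (x # \<alpha> @ \<beta>2)"
        by blast
      then show "(y, y') \<in> (\<lambda>(\<alpha>, \<beta>1, \<beta>2). (last (x # \<alpha> @ \<beta>1), last (x # \<alpha> @ \<beta>2))) ` 
        {\<tau> \<in> tripods V E [x]. \<forall>e\<in>tripod_edges [x] \<tau>. z e}"
        by (intro image_eqI[of _ _ "(\<alpha>, \<beta>1, \<beta>2)"]) (simp_all del: tripod_edges.simps)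
    qed
  qed simp
  then show ?thesis by (simp add: card_cartesian_product power2_eq_square)
qed

end

theorem theorem1:
  fixes M :: "'w measure" and V :: "'v set" and E :: "'v set set"
    and D N R :: nat and p \<nu> :: real
    and \<zeta> :: "'v set \<Rightarrow> 'w \<Rightarrow> bool" and X :: "'w \<Rightarrow> 'v" and S :: "'w \<Rightarrow> real"
  assumes "finite_simple_graph V E" and "V \<noteq> {}" and "regular_graph V E D"
    and "card V = N"
    and "0 < p" and "p < 1"
    and "prob_space M"
    and "bond_percolation M E p \<zeta>"
    and "independent_uniform_vertex M V E \<zeta> X"
    and "S = (\<lambda>\<omega>. real (cluster_size V E \<zeta> X \<omega>))"
    and "\<nu> = (real D - 1) * p" and "R = N - 1" and "\<nu> \<noteq> 1"
  shows "prob_space.expectation M S \<le> 1 + real D * p * ((1 - \<nu> ^ R) / (1 - \<nu>)) \<and>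
    prob_space.expectation M (\<lambda>\<omega>. (S \<omega>)\<^sup>2) \<le>
      (1 + real D * p * ((1 - \<nu> ^ R) / (1 - \<nu>)))\<^sup>2
      + real D * p * (1 - p) / (1 - \<nu>)\<^sup>2
        * ((1 - \<nu> ^ R) * (1 + \<nu> ^ (R + 1)) / (1 - \<nu>) - 2 * real R * \<nu> ^ R)"
proof
  interpret prob_space M by fact
  interpret percolation_weights V E D p \<nu>
    by unfold_locales fact+
  note perc = assms(8) less_imp_le[OF assms(5)] less_imp_le[OF assms(6)] finite_E finite_V assms(2,9)
  have S: "S \<omega> = card (open_cluster V E (\<lambda>e. \<zeta> e \<omega>) (X \<omega>))" for \<omega>
    by (simp add: assms(10) cluster_size_def)
  have R: "card V - 1 = R" using assms by simp
  have "expectation S \<le> 1 + real D * p * gsum R"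
  proof (rule expectation_le_sum_edge_weights[OF perc])
    fix x assume x: "x \<in> V"
    have "(\<Sum>\<beta>\<in>extensions V E [x]. p ^ card (path_edges (x # \<beta>))) = extension_weight [x]"
      unfolding extension_weight_def
      by (intro sum.cong refl)
        (auto simp: extensions_def self_avoiding_def card_path_edges[of "x # _"])
    then show "(\<Sum>\<beta>\<in>extensions V E [x]. p ^ card (path_edges (x # \<beta>))) \<le> 1 + real D * p * gsum R"
      using extension_weight_singleton_le[OF x] by (simp only: R)
  next
    fix \<omega>
    show "S \<omega> \<le> card {\<beta> \<in> extensions V E [X \<omega>]. \<forall>e\<in>path_edges (X \<omega> # \<beta>). \<zeta> e \<omega>}"
      unfolding S of_nat_le_iff by (rule card_open_cluster_le)
  qed (simp_all add: S open_cluster_outside, auto simp: extensions_def self_avoiding_def)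
  then show "expectation S \<le> 1 + real D * p * ((1 - \<nu> ^ R) / (1 - \<nu>))"
    by (simp only: gsum_closed[OF assms(13)])
  have "expectation (\<lambda>\<omega>. (S \<omega>)\<^sup>2) \<le> (1 + real D * p * gsum R)\<^sup>2 + real D * p * (1 - p) * sqsum R"
  proof (rule expectation_le_sum_edge_weights[OF perc])
    fix x assume x: "x \<in> V"
    have "(\<Sum>\<tau>\<in>tripods V E [x]. p ^ card (tripod_edges [x] \<tau>)) = tripod_weight [x]"
      unfolding tripod_weight_def by (intro sum.cong refl) (simp add: card_tripod_edges)
    then show "(\<Sum>\<tau>\<in>tripods V E [x]. p ^ card (tripod_edges [x] \<tau>)) \<le> 
        (1 + real D * p * gsum R)\<^sup>2 + real D * p * (1 - p) * sqsum R"
      using tripod_weight_singleton_le[OF x] by (simp only: R)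
  next
    fix \<omega>
    show "(S \<omega>)\<^sup>2 \<le> card {\<tau> \<in> tripods V E [X \<omega>]. \<forall>e\<in>tripod_edges [X \<omega>] \<tau>. \<zeta> e \<omega>}"
      using card_open_cluster_square_le[of "\<lambda>e. \<zeta> e \<omega>" "X \<omega>"]
      unfolding S of_nat_power[symmetric] of_nat_le_iff .
  qed (simp_all add: S open_cluster_outside,
      auto simp: tripods_def forks_def extensions_def self_avoiding_def)
  then show "expectation (\<lambda>\<omega>. (S \<omega>)\<^sup>2) \<le>
      (1 + real D * p * ((1 - \<nu> ^ R) / (1 - \<nu>)))\<^sup>2
      + real D * p * (1 - p) / (1 - \<nu>)\<^sup>2
        * ((1 - \<nu> ^ R) * (1 + \<nu> ^ (R + 1)) / (1 - \<nu>) - 2 * real R * \<nu> ^ R)"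
    by (simp only: gsum_closed[OF assms(13)] sqsum_closed[OF assms(13)] times_divide_eq_left times_divide_eq_right)
qed

end
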